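(* Let $F:\Delta\to\mathbb R^n$ be continuous and let $c\in\mathbb R^n$ be a constant vector with $c>0$ componentwise. For $\epsilon>0$ define $F_\epsilon:\Delta\to\mathbb R^n$ componentwise by $$F_{\epsilon,i}(\sigma)=\mathbb E_{Y\sim{\rm Dir}(\sigma/\epsilon+c)}[F_i(Y)]=\int_\Delta F_i(y)\,{\rm Dir}(y;\sigma/\epsilon+c)\,dy .$$ Then for every $\epsilon>0$, $F_\epsilon$ is real-analytic on $\Delta$.
   Context: $\Delta=\{\sigma\in\mathbb R^n:\sigma\ge0,\ \sum_i\sigma_i=1\}$ is the standard simplex. For $\alpha\in\mathbb R^n$ with $\alpha>0$, ${\rm Dir}(\alpha)$ is the Dirichlet distribution on $\Delta$ with density ${\rm Dir}(y;\alpha)=\frac1{B(\alpha)}\prod_{i=1}^n y_i^{\alpha_i-1}$ with respect to Lebesgue measure $dy$ on $\Delta$, where $B(\alpha)$ is the (multivariate) Beta function. Real-analytic on $\Delta$ means that every point of $\Delta$ has a neighborhood in $\mathbb R^n$ on which the function (given by the same formula) is real-analytic. *)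

theory Defs
  imports "HOL-Analysis.Analysis"
begin

section \<open>The standard simplex and its Lebesgue measure\<close>

definition std_simplex :: "(real ^ 'n) set" where
  "std_simplex = {\<sigma>. (\<forall>i. 0 \<le> \<sigma> $ i) \<and> (\<Sum>i\<in>UNIV. \<sigma> $ i) = 1}"

definition simplex_chart :: "'n \<Rightarrow> ('n \<Rightarrow> real) \<Rightarrow> real ^ 'n" where
  "simplex_chart k z = (\<chi> i. if i = k then 1 - (\<Sum>j\<in>UNIV - {k}. z j) else z i)"

text \<open>
  The simplex is a null set for the Lebesgue measure of the ambient space.
  As usual for the Dirichlet distribution, Lebesgue measure on it is the
  (n - 1)-dimensional Lebesgue measure in all coordinates but one, the remaining
  coordinate k being determined by the constraint that the coordinates sum to 1.
  The space of this measure is the simplex, so values of integrands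
  outside the simplex are irrelevant.
\<close>

definition simplex_lborel_wrt :: "'n \<Rightarrow> (real ^ 'n) measure" where
  "simplex_lborel_wrt k =
     restrict_space (distr (\<Pi>\<^sub>M i\<in>UNIV - {k}. lborel) borel (simplex_chart k)) std_simplex"

text \<open>The choice of k is immaterial, see \<open>simplex_lborel_eq\<close> below.\<close>

definition simplex_lborel :: "(real ^ 'n) measure" where
  "simplex_lborel = simplex_lborel_wrt (SOME k. True)"

lemma closed_std_simplex: "closed (std_simplex :: (real ^ 'n) set)"
proof -
  have "std_simplex = (\<Inter>i. {\<sigma> :: real ^ 'n. 0 \<le> \<sigma> $ i}) \<inter> {\<sigma>. (\<Sum>i\<in>UNIV. \<sigma> $ i) = 1}"
    by (auto simp: std_simplex_def)
  moreover have "closed ((\<Inter>i. {\<sigma> :: real ^ 'n. 0 \<le> \<sigma> $ i}) \<inter> {\<sigma>. (\<Sum>i\<in>UNIV. \<sigma> $ i) = 1})"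
    by (intro closed_INT closed_Int ballI closed_Collect_le closed_Collect_eq continuous_intros)
  ultimately show ?thesis by simp
qed

lemma std_simplex_borel [measurable]: "(std_simplex :: (real ^ 'n) set) \<in> sets borel"
  using closed_std_simplex by (rule borel_closed)

lemma measurable_simplex_chart [measurable]:
  "simplex_chart k \<in> borel_measurable (\<Pi>\<^sub>M i\<in>UNIV - {k :: 'n :: finite}. (lborel :: real measure))"
proof (rule borel_measurable_euclidean_space[THEN iffD2, rule_format])
  fix b :: "real ^ 'n" assume "b \<in> Basis"
  then obtain i where b: "b = axis i 1" by (auto simp: Basis_vec_def)
  show "(\<lambda>z. simplex_chart k z \<bullet> b) \<in> borel_measurable (\<Pi>\<^sub>M i\<in>UNIV - {k}. lborel)"
  proof (cases "i = k")
    case True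
    then show ?thesis by (simp add: b inner_axis simplex_chart_def)
  next
    case False
    then have "i \<in> UNIV - {k}" by simp
    with False show ?thesis by (simp add: b inner_axis simplex_chart_def)
  qed
qed

lemma space_simplex_lborel [simp]: "space simplex_lborel = std_simplex"
  by (simp add: simplex_lborel_def simplex_lborel_wrt_def space_restrict_space)

lemma sets_simplex_lborel [measurable_cong]:
  "sets simplex_lborel = sets (restrict_space borel std_simplex)"
  unfolding simplex_lborel_def simplex_lborel_wrt_def by (rule sets_restrict_space_cong) simp

lemma simplex_chart_measure_eq:
  fixes k l :: "'n :: finite"
  shows "distr (\<Pi>\<^sub>M i\<in>UNIV - {k}. lborel) borel (simplex_chart k) =
         distr (\<Pi>\<^sub>M i\<in>UNIV - {l}. lborel) borel (simplex_chart l)"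
proof (cases "k = l")
  case False
  define I where "I = UNIV - {k, l}"
  have Ik: "UNIV - {k} = insert l I" and Il: "UNIV - {l} = insert k I"
    and nI: "k \<notin> I" "l \<notin> I" and fI: "finite I"
    using False by (auto simp: I_def)
  interpret product_sigma_finite "\<lambda>_ :: 'n. (lborel :: real measure)"
    by standard
  show ?thesis
  proof (rule measure_eqI)
    fix A :: "(real ^ 'n) set"
    assume "A \<in> sets (distr (\<Pi>\<^sub>M i\<in>UNIV - {k}. lborel) borel (simplex_chart k))"
    then have A [measurable]: "A \<in> sets borel" by simp
    have em: "emeasure (distr (\<Pi>\<^sub>M i\<in>UNIV - {m}. lborel) borel (simplex_chart m)) A =
        (\<integral>\<^sup>+ z. indicator A (simplex_chart m z) \<partial>(\<Pi>\<^sub>M i\<in>UNIV - {m}. lborel))" for m :: 'n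
      by (subst nn_integral_indicator[symmetric], simp, subst nn_integral_distr) auto
    have meas: "(\<lambda>z. indicator A (simplex_chart m z) :: ennreal)
        \<in> borel_measurable (\<Pi>\<^sub>M i\<in>UNIV - {m}. lborel)" for m :: 'n
      by measurable
    have ek: "(\<integral>\<^sup>+ z. indicator A (simplex_chart k z) \<partial>(\<Pi>\<^sub>M i\<in>UNIV - {k}. lborel)) =
        (\<integral>\<^sup>+ z. (\<integral>\<^sup>+ t. indicator A (simplex_chart k (z(l := t))) \<partial>lborel) \<partial>(\<Pi>\<^sub>M i\<in>I. lborel))"
      unfolding Ik by (rule product_nn_integral_insert[OF fI nI(2)]) (use meas[of k] Ik in simp)
    have el: "(\<integral>\<^sup>+ z. indicator A (simplex_chart l z) \<partial>(\<Pi>\<^sub>M i\<in>UNIV - {l}. lborel)) =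
        (\<integral>\<^sup>+ z. (\<integral>\<^sup>+ t. indicator A (simplex_chart l (z(k := t))) \<partial>lborel) \<partial>(\<Pi>\<^sub>M i\<in>I. lborel))"
      unfolding Il by (rule product_nn_integral_insert[OF fI nI(1)]) (use meas[of l] Il in simp)
    have swap: "simplex_chart k (z(l := t)) = simplex_chart l (z(k := 1 - (\<Sum>j\<in>I. z j) - t))"
      for z t
    proof -
      have "(\<Sum>j\<in>UNIV - {k}. (z(l := t)) j) = t + (\<Sum>j\<in>I. z j)"
        unfolding Ik using nI fI by (auto intro!: sum.cong)
      moreover have "(\<Sum>j\<in>UNIV - {l}. (z(k := u)) j) = u + (\<Sum>j\<in>I. z j)" for u
        unfolding Il using nI fI by (auto intro!: sum.cong)
      ultimately show ?thesis
        using False by (simp add: simplex_chart_def vec_eq_iff)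
    qed
    have "(\<integral>\<^sup>+ t. indicator A (simplex_chart k (z(l := t))) \<partial>lborel) =
        (\<integral>\<^sup>+ t. indicator A (simplex_chart l (z(k := t))) \<partial>lborel)"
      if "z \<in> space (\<Pi>\<^sub>M i\<in>I. lborel)" for z
    proof -
      have [measurable]: "(\<lambda>t. z(k := t)) \<in> lborel \<rightarrow>\<^sub>M (\<Pi>\<^sub>M i\<in>UNIV - {l}. lborel)"
        unfolding Il using that nI by (intro measurable_component_update) auto
      have "(\<lambda>t. indicator A (simplex_chart l (z(k := t))) :: ennreal) \<in> borel_measurable lborel"
        by measurable
      then show ?thesis
        by (subst nn_integral_real_affine[where c = "-1" and t = "1 - (\<Sum>j\<in>I. z j)"
              and f = "\<lambda>t. indicator A (simplex_chart l (z(k := t)))"])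
          (simp_all add: swap)
    qed
    then show "emeasure (distr (\<Pi>\<^sub>M i\<in>UNIV - {k}. lborel) borel (simplex_chart k)) A =
        emeasure (distr (\<Pi>\<^sub>M i\<in>UNIV - {l}. lborel) borel (simplex_chart l)) A"
      unfolding em ek el by (rule nn_integral_cong)
  qed simp
qed simp

lemma simplex_lborel_eq: "simplex_lborel = simplex_lborel_wrt k"
  unfolding simplex_lborel_def simplex_lborel_wrt_def
  by (subst simplex_chart_measure_eq[of _ k]) (rule refl)


section \<open>The Dirichlet distribution\<close>

definition multi_Beta :: "real ^ 'n \<Rightarrow> real" where
  "multi_Beta \<alpha> = (\<Prod>i\<in>UNIV. Gamma (\<alpha> $ i)) / Gamma (\<Sum>i\<in>UNIV. \<alpha> $ i)"

definition dirichlet_density :: "real ^ 'n \<Rightarrow> real ^ 'n \<Rightarrow> real" where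
  "dirichlet_density \<alpha> y = 1 / multi_Beta \<alpha> * (\<Prod>i\<in>UNIV. (y $ i) powr (\<alpha> $ i - 1))"

text \<open>Only meaningful when all components of the parameter are positive.\<close>

definition dirichlet :: "real ^ 'n \<Rightarrow> (real ^ 'n) measure" where
  "dirichlet \<alpha> = density simplex_lborel (\<lambda>y. ennreal (dirichlet_density \<alpha> y))"

definition dirichlet_smoothing ::
    "(real ^ 'n \<Rightarrow> real ^ 'n) \<Rightarrow> real ^ 'n \<Rightarrow> real \<Rightarrow> real ^ 'n \<Rightarrow> real ^ 'n" where
  "dirichlet_smoothing F c \<epsilon> \<sigma> = (\<chi> i. \<integral>y. F y $ i \<partial>dirichlet ((1 / \<epsilon>) *\<^sub>R \<sigma> + c))"

lemma dirichlet_density_nonneg: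
  assumes "\<And>i. 0 < \<alpha> $ i"
  shows "0 \<le> dirichlet_density \<alpha> y"
proof -
  have "0 < (\<Sum>i\<in>UNIV. \<alpha> $ i)" using assms by (intro sum_pos) auto
  then have "0 < multi_Beta \<alpha>"
    using assms by (auto simp: multi_Beta_def intro!: divide_pos_pos prod_pos Gamma_real_pos)
  then show ?thesis by (auto simp: dirichlet_density_def intro!: divide_nonneg_pos prod_nonneg)
qed

lemma dirichlet_smoothing_eq_integral_density:
  fixes F :: "real ^ 'n \<Rightarrow> real ^ 'n"
  assumes "continuous_on std_simplex F"
    and "\<And>i. 0 < ((1 / \<epsilon>) *\<^sub>R \<sigma> + c) $ i"
  shows "dirichlet_smoothing F c \<epsilon> \<sigma> $ i =
    (\<integral>y. F y $ i * dirichlet_density ((1 / \<epsilon>) *\<^sub>R \<sigma> + c) y \<partial>simplex_lborel)"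
proof -
  let ?\<alpha> = "(1 / \<epsilon>) *\<^sub>R \<sigma> + c"
  have F: "(\<lambda>y. F y $ i) \<in> borel_measurable simplex_lborel"
    unfolding measurable_cong_sets[OF sets_simplex_lborel refl]
    by (intro borel_measurable_continuous_on_restrict continuous_intros assms)
  have comp: "(\<lambda>y. y $ j) \<in> borel_measurable simplex_lborel" for j
    unfolding measurable_cong_sets[OF sets_simplex_lborel refl]
    by (intro borel_measurable_continuous_on_restrict continuous_intros)
  have D: "dirichlet_density ?\<alpha> \<in> borel_measurable simplex_lborel"
    unfolding dirichlet_density_def using comp by measurable
  have "(\<integral>y. F y $ i \<partial>dirichlet ?\<alpha>) = (\<integral>y. dirichlet_density ?\<alpha> y *\<^sub>R (F y $ i) \<partial>simplex_lborel)"
    unfolding dirichlet_def using assms(2)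
    by (intro integral_density F D AE_I2 dirichlet_density_nonneg) auto
  then show ?thesis by (simp add: dirichlet_smoothing_def mult.commute)
qed


section \<open>Real-analytic functions of several variables\<close>

text \<open>
  Near x the function is the sum of a power series indexed by multi-indices;
  \<open>has_sum\<close> is unconditional convergence, hence no ordering of the multi-indices is needed.
\<close>

definition real_analytic_at :: "(real ^ 'n \<Rightarrow> 'b :: real_normed_vector) \<Rightarrow> real ^ 'n \<Rightarrow> bool" where
  "real_analytic_at f x \<longleftrightarrow>
     (\<exists>r > 0. \<exists>a :: ('n \<Rightarrow> nat) \<Rightarrow> 'b. \<forall>y \<in> ball x r.
        ((\<lambda>\<nu>. (\<Prod>i\<in>UNIV. (y $ i - x $ i) ^ \<nu> i) *\<^sub>R a \<nu>) has_sum f y) UNIV)"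

text \<open>The set S need not be open: analyticity is required on a neighborhood of each of its points.\<close>

definition real_analytic_on :: "(real ^ 'n \<Rightarrow> 'b :: real_normed_vector) \<Rightarrow> (real ^ 'n) set \<Rightarrow> bool" where
  "real_analytic_on f S \<longleftrightarrow>
     (\<forall>x\<in>S. \<exists>U. open U \<and> x \<in> U \<and> (\<forall>y\<in>U. real_analytic_at f y))"

end

theory Submission
  imports Defs "HOL-Complex_Analysis.Cauchy_Integral_Formula"
begin

text \<open>
  Put \<open>\<alpha> = \<sigma> / \<epsilon> + c\<close>. The j-th component of the smoothing is the product of
  \<open>\<Gamma>(\<Sum>i. \<alpha>\<^sub>i)\<close>, the reciprocals \<open>1 / \<Gamma>(\<alpha>\<^sub>i)\<close> and the integral of
  \<open>F\<^sub>j(y) \<Prod>i. y\<^sub>i powr (\<alpha>\<^sub>i - 1)\<close>. Both the first and the last factor have the form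
  \<open>\<integral> f exp (\<Sum>i. t\<^sub>i g\<^sub>i)\<close> with \<open>t = \<alpha> - \<alpha>\<^sub>0\<close>, where \<open>g\<^sub>i\<close> is a logarithm: integrating the
  exponential series termwise gives a power series in \<open>t\<close>, by dominated convergence with majorant
  \<open>\<bar>f\<bar> exp (\<Sum>i. \<bar>t\<^sub>i g\<^sub>i\<bar>)\<close>, which is integrable for small \<open>t\<close>. The reciprocals are
  handled by the entire function \<open>rGamma\<close>.
\<close>

section \<open>Series over multi-indices\<close>

lemma finite_to_nat_less: "finite {i :: 'i :: countable. to_nat i < n}"
  by (rule finite_imageD[of to_nat]) (auto intro: finite_subset[of _ "{..<n}"])

text \<open>Turns the net limit in \<open>has_sum\<close> into a limit of a sequence, the form that
  dominated convergence accepts.\<close>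

lemma filterlim_to_nat_initial_finite_subsets:
  "filterlim (\<lambda>n. {i :: 'i :: countable. to_nat i < n}) (finite_subsets_at_top UNIV) sequentially"
  unfolding filterlim_finite_subsets_at_top
proof safe
  fix X :: "'i set" assume "finite X"
  obtain N where "\<forall>i\<in>X. to_nat i < N"
    using finite_nat_set_iff_bounded[of "to_nat ` X"] \<open>finite X\<close> by auto
  then show "\<forall>\<^sub>F n in sequentially. finite {i :: 'i. to_nat i < n} \<and> X \<subseteq> {i. to_nat i < n} \<and> {i. to_nat i < n} \<subseteq> UNIV"
    unfolding eventually_sequentially using finite_to_nat_less by (auto intro!: exI[of _ N] dest: order_less_le_trans)
qed

text \<open>Dominated convergence along an enumeration of the indices gives the limit of the
  integrated partial sums. The same majorant makes the series of integrals absolutely summable, so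
  its unordered sum exists and equals that limit.\<close>

lemma has_sum_integral_dominated:
  fixes f :: "'i :: countable \<Rightarrow> 'a \<Rightarrow> real"
  assumes meas: "\<And>i. f i \<in> borel_measurable M" and g: "integrable M g"
    and bound: "\<And>S y. finite S \<Longrightarrow> y \<in> space M \<Longrightarrow> (\<Sum>i\<in>S. \<bar>f i y\<bar>) \<le> g y"
    and sum: "\<And>y. y \<in> space M \<Longrightarrow> ((\<lambda>i. f i y) has_sum F y) UNIV"
  shows "((\<lambda>i. \<integral>y. f i y \<partial>M) has_sum (\<integral>y. F y \<partial>M)) UNIV"
proof -
  define S where "S n = {i :: 'i. to_nat i < n}" for n
  have S: "filterlim S (finite_subsets_at_top UNIV) sequentially"
    unfolding S_def by (rule filterlim_to_nat_initial_finite_subsets)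
  have finS: "finite (S n)" for n unfolding S_def by (rule finite_to_nat_less)
  have lim: "(\<lambda>n. \<Sum>i\<in>S n. f i y) \<longlonglongrightarrow> F y" if "y \<in> space M" for y
    using filterlim_compose[OF sum[OF that, unfolded has_sum_def] S] .
  have [measurable]: "F \<in> borel_measurable M"
    by (rule borel_measurable_LIMSEQ_real[OF lim]) (use meas in auto)
  have int: "integrable M (f i)" for i
  proof (rule Bochner_Integration.integrable_bound[OF g meas AE_I2])
    show "norm (f i y) \<le> norm (g y)" if "y \<in> space M" for y
      using bound[of "{i}" y] that by simp
  qed
  have "(\<lambda>n. \<integral>y. (\<Sum>i\<in>S n. f i y) \<partial>M) \<longlonglongrightarrow> (\<integral>y. F y \<partial>M)"
  proof (rule integral_dominated_convergence[OF _ _ g])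
    show "AE y in M. norm (\<Sum>i\<in>S n. f i y) \<le> g y" for n
      using order_trans[OF sum_abs bound[OF finS]] by (intro AE_I2) auto
  qed (use meas lim in auto)
  then have lim_int: "(\<lambda>n. \<Sum>i\<in>S n. \<integral>y. f i y \<partial>M) \<longlonglongrightarrow> (\<integral>y. F y \<partial>M)"
    using int by simp
  \<comment> \<open>Convergence along one enumeration does not give unordered convergence; absolute
    summability does, since every finite sum is at most the integral of \<open>g\<close>.\<close>
  have "(\<lambda>i. \<bar>\<integral>y. f i y \<partial>M\<bar>) summable_on UNIV"
  proof (rule nonneg_bdd_above_summable_on)
    have "(\<Sum>i\<in>T. \<bar>\<integral>y. f i y \<partial>M\<bar>) \<le> (\<integral>y. g y \<partial>M)" if "finite T" for T
    proof -
      have "(\<Sum>i\<in>T. \<bar>\<integral>y. f i y \<partial>M\<bar>) \<le> (\<Sum>i\<in>T. \<integral>y. \<bar>f i y\<bar> \<partial>M)"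
        by (intro sum_mono integral_abs_bound)
      also have "\<dots> = (\<integral>y. (\<Sum>i\<in>T. \<bar>f i y\<bar>) \<partial>M)" using int by simp
      also have "\<dots> \<le> (\<integral>y. g y \<partial>M)"
        using int g bound[OF that] by (intro integral_mono) auto
      finally show ?thesis .
    qed
    then show "bdd_above (sum (\<lambda>i. \<bar>\<integral>y. f i y \<partial>M\<bar>) ` {F. F \<subseteq> UNIV \<and> finite F})"
      by (intro bdd_aboveI[of _ "\<integral>y. g y \<partial>M"]) auto
  qed simp
  then have "(\<lambda>i. \<integral>y. f i y \<partial>M) summable_on UNIV"
    by (subst summable_on_iff_abs_summable_on_real) simp
  then obtain s where s: "((\<lambda>i. \<integral>y. f i y \<partial>M) has_sum s) UNIV"
    by (auto simp: summable_on_def)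
  have "(\<integral>y. F y \<partial>M) = s"
    by (rule LIMSEQ_unique[OF lim_int filterlim_compose[OF s[unfolded has_sum_def] S]])
  with s show ?thesis by simp
qed

section \<open>Products of one-variable series and the multivariate exponential series\<close>

lemma sum_prod_le_prod:
  fixes f :: "'n :: finite \<Rightarrow> 'b \<Rightarrow> real"
  assumes "\<And>i b. 0 \<le> f i b" and "\<And>i T. finite T \<Longrightarrow> (\<Sum>b\<in>T. f i b) \<le> S i"
    and "finite A"
  shows "(\<Sum>\<nu>\<in>A. \<Prod>i\<in>UNIV. f i (\<nu> i)) \<le> (\<Prod>i\<in>UNIV. S i)"
proof -
  \<comment> \<open>\<open>T\<close> collects all entries occurring in \<open>A\<close>. Enlarging
    \<open>A\<close> to the full box over \<open>T\<close> only adds nonnegative terms, and over a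
    box the sum of products factors.\<close>
  define T where "T = (\<Union>\<nu>\<in>A. range \<nu>)"
  have T: "finite T" "A \<subseteq> PiE UNIV (\<lambda>_. T)" using assms(3) by (auto simp: T_def)
  have "(\<Sum>\<nu>\<in>A. \<Prod>i\<in>UNIV. f i (\<nu> i)) \<le> (\<Sum>\<nu>\<in>PiE UNIV (\<lambda>_. T). \<Prod>i\<in>UNIV. f i (\<nu> i))"
    using T assms by (intro sum_mono2 finite_PiE prod_nonneg) auto
  also have "\<dots> = (\<Prod>i\<in>UNIV. \<Sum>b\<in>T. f i b)"
    using T by (intro prod_sum_PiE[symmetric]) auto
  also have "\<dots> \<le> (\<Prod>i\<in>UNIV. S i)"
    using T assms by (intro prod_mono) (auto intro: sum_nonneg)
  finally show ?thesis .
qed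

text \<open>For reals, unconditional summability is absolute summability. The finite sums of
  absolute values are bounded by the product of the sums of the \<open>\<bar>f i b\<bar>\<close>, so
  the product family is summable and its value factors.\<close>

lemma has_sum_prod_UNIV:
  fixes f :: "'n :: finite \<Rightarrow> 'b \<Rightarrow> real"
  assumes "\<And>i. (f i has_sum S i) UNIV"
  shows "((\<lambda>\<nu>. \<Prod>i\<in>UNIV. f i (\<nu> i)) has_sum (\<Prod>i\<in>UNIV. S i)) UNIV"
proof -
  have abs: "(\<lambda>b. \<bar>f i b\<bar>) summable_on UNIV" for i
    using summable_on_iff_abs_summable_on_real[THEN iffD1, OF has_sum_imp_summable[OF assms[of i]]] by simp
  have "(\<lambda>\<nu>. \<bar>\<Prod>i\<in>UNIV. f i (\<nu> i)\<bar>) summable_on UNIV"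
  proof (rule nonneg_bdd_above_summable_on)
    have "(\<Sum>\<nu>\<in>A. \<bar>\<Prod>i\<in>UNIV. f i (\<nu> i)\<bar>) \<le> (\<Prod>i\<in>UNIV. infsum (\<lambda>b. \<bar>f i b\<bar>) UNIV)" if "finite A" for A
      unfolding abs_prod using that abs
      by (intro sum_prod_le_prod finite_sum_le_infsum) auto
    then show "bdd_above (sum (\<lambda>\<nu>. \<bar>\<Prod>i\<in>UNIV. f i (\<nu> i)\<bar>) ` {F. F \<subseteq> UNIV \<and> finite F})"
      by (intro bdd_aboveI[of _ "\<Prod>i\<in>UNIV. infsum (\<lambda>b. \<bar>f i b\<bar>) UNIV"]) auto
  qed simp
  then have "(\<lambda>\<nu>. \<Prod>i\<in>UNIV. f i (\<nu> i)) summable_on UNIV"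
    by (subst summable_on_iff_abs_summable_on_real) simp
  moreover have "infsum (\<lambda>\<nu>. \<Prod>i\<in>UNIV. f i (\<nu> i)) (PiE UNIV (\<lambda>_. UNIV)) = (\<Prod>i\<in>UNIV. infsum (f i) UNIV)"
    using abs by (intro infsum_prod_PiE_abs) auto
  ultimately show ?thesis using infsumI[OF assms] by (simp add: has_sum_iff)
qed

lemma exp_has_sum_real: "((\<lambda>k. x ^ k / fact k) has_sum exp x) (UNIV :: nat set)" for x :: real
proof (rule norm_summable_imp_has_sum)
  show "summable (\<lambda>k. norm (x ^ k / fact k))"
    using summable_norm_exp[of x] by (simp add: divide_inverse mult.commute)
  show "(\<lambda>k. x ^ k / fact k) sums exp x"
    using exp_converges[of x] by (simp add: divide_inverse mult.commute)
qed

lemma exp_sum_has_sum: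
  fixes u :: "'n :: finite \<Rightarrow> real"
  shows "((\<lambda>\<nu>. \<Prod>i\<in>UNIV. u i ^ \<nu> i / fact (\<nu> i)) has_sum exp (\<Sum>i\<in>UNIV. u i)) UNIV"
  using has_sum_prod_UNIV[OF exp_has_sum_real, of u] by (simp add: exp_sum)

lemma has_sum_exp_integral:
  fixes g :: "'n :: finite \<Rightarrow> 'a \<Rightarrow> real" and t :: "'n \<Rightarrow> real"
  assumes [measurable]: "f \<in> borel_measurable M" "\<And>i. g i \<in> borel_measurable M"
    and int: "integrable M (\<lambda>y. f y * exp (\<Sum>i\<in>UNIV. \<bar>t i * g i y\<bar>))"
  shows "((\<lambda>\<nu>. (\<Prod>i\<in>UNIV. t i ^ \<nu> i) * (\<integral>y. f y * (\<Prod>i\<in>UNIV. g i y ^ \<nu> i / fact (\<nu> i)) \<partial>M))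
    has_sum (\<integral>y. f y * exp (\<Sum>i\<in>UNIV. t i * g i y) \<partial>M)) UNIV"
proof -
  \<comment> \<open>Moving the monomial into the integrand turns the power series in
    \<open>t\<close> into a termwise integral of the exponential series at
    \<open>t i * g i y\<close>.\<close>
  have eq: "(\<Prod>i\<in>UNIV. t i ^ \<nu> i) * (\<integral>y. f y * (\<Prod>i\<in>UNIV. g i y ^ \<nu> i / fact (\<nu> i)) \<partial>M) =
      (\<integral>y. f y * (\<Prod>i\<in>UNIV. (t i * g i y) ^ \<nu> i / fact (\<nu> i)) \<partial>M)" for \<nu>
    by (subst integral_mult_right_zero[symmetric])
       (simp add: power_mult_distrib prod.distrib prod_dividef mult_ac)
  show ?thesis unfolding eq
  proof (rule has_sum_integral_dominated)
    show "integrable M (\<lambda>y. \<bar>f y * exp (\<Sum>i\<in>UNIV. \<bar>t i * g i y\<bar>)\<bar>)"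
      using int by (rule integrable_abs)
    fix y
    show "((\<lambda>\<nu>. f y * (\<Prod>i\<in>UNIV. (t i * g i y) ^ \<nu> i / fact (\<nu> i))) has_sum
        f y * exp (\<Sum>i\<in>UNIV. t i * g i y)) UNIV"
      by (intro has_sum_cmult_right exp_sum_has_sum)
    fix S :: "('n \<Rightarrow> nat) set" assume S: "finite S"
    have "(\<Sum>\<nu>\<in>S. \<bar>f y * (\<Prod>i\<in>UNIV. (t i * g i y) ^ \<nu> i / fact (\<nu> i))\<bar>) =
        \<bar>f y\<bar> * (\<Sum>\<nu>\<in>S. \<Prod>i\<in>UNIV. \<bar>t i * g i y\<bar> ^ \<nu> i / fact (\<nu> i))"
      by (simp add: abs_mult abs_prod power_abs sum_distrib_left)
    also have "\<dots> \<le> \<bar>f y\<bar> * exp (\<Sum>i\<in>UNIV. \<bar>t i * g i y\<bar>)"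
      \<comment> \<open>The right-hand exponential is the full sum of the nonnegative series with
        arguments \<open>\<bar>t i * g i y\<bar>\<close>, hence bounds each finite part.\<close>
      unfolding infsumI[OF exp_sum_has_sum, symmetric]
      using S has_sum_imp_summable[OF exp_sum_has_sum]
      by (intro mult_left_mono finite_sum_le_infsum prod_nonneg) auto
    finally show "(\<Sum>\<nu>\<in>S. \<bar>f y * (\<Prod>i\<in>UNIV. (t i * g i y) ^ \<nu> i / fact (\<nu> i))\<bar>) \<le>
        \<bar>f y * exp (\<Sum>i\<in>UNIV. \<bar>t i * g i y\<bar>)\<bar>" by (simp add: abs_mult)
  qed measurable
qed

section \<open>Real-analytic functions\<close>

lemma real_analytic_atE:
  assumes "real_analytic_at f x"
  obtains r a where "0 < r" "\<And>y. y \<in> ball x r \<Longrightarrow>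
    ((\<lambda>\<nu>. (\<Prod>i\<in>UNIV. (y $ i - x $ i) ^ \<nu> i) *\<^sub>R a \<nu>) has_sum f y) UNIV"
  using assms unfolding real_analytic_at_def by blast

lemma real_analytic_atI:
  assumes "0 < r" "\<And>y. y \<in> ball x r \<Longrightarrow>
    ((\<lambda>\<nu>. (\<Prod>i\<in>UNIV. (y $ i - x $ i) ^ \<nu> i) *\<^sub>R a \<nu>) has_sum f y) UNIV"
  shows "real_analytic_at f x"
  using assms unfolding real_analytic_at_def by blast

lemma real_analytic_at_cong:
  assumes "real_analytic_at g x" "0 < d" "\<And>y. y \<in> ball x d \<Longrightarrow> f y = g y"
  shows "real_analytic_at f x"
proof -
  obtain r a where "0 < r" "\<And>y. y \<in> ball x r \<Longrightarrow>
      ((\<lambda>\<nu>. (\<Prod>i\<in>UNIV. (y $ i - x $ i) ^ \<nu> i) *\<^sub>R a \<nu>) has_sum g y) UNIV"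
    using assms(1) by (rule real_analytic_atE) blast
  with assms(2,3) show ?thesis by (intro real_analytic_atI[of "min r d" _ a]) simp_all
qed

section \<open>Closure of real-analyticity under products, vectors and affine substitution\<close>

lemma has_sum_mult_Times_real:
  fixes f :: "'a \<Rightarrow> real" and g :: "'b \<Rightarrow> real"
  assumes f: "(f has_sum s) A" and g: "(g has_sum t) B"
  shows "((\<lambda>(x, y). f x * g y) has_sum s * t) (A \<times> B)"
proof (rule has_sum_SigmaI)
  show "((\<lambda>y. case (x, y) of (x, y) \<Rightarrow> f x * g y) has_sum f x * t) B" for x
    using has_sum_cmult_right[OF g] by simp
  show "((\<lambda>x. f x * t) has_sum s * t) A"
    using has_sum_cmult_left[OF f] .
  \<comment> \<open>Iterated sums determine the double sum only once it is known to be summable;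
    this follows from the absolute summability of both factors.\<close>
  have "(\<lambda>(x, y). \<bar>f x * g y\<bar>) summable_on A \<times> B"
  proof (rule summable_on_SigmaI)
    have f': "(\<lambda>x. \<bar>f x\<bar>) summable_on A" and g': "(\<lambda>y. \<bar>g y\<bar>) summable_on B"
      using summable_on_iff_abs_summable_on_real[THEN iffD1, OF has_sum_imp_summable[OF f]]
        summable_on_iff_abs_summable_on_real[THEN iffD1, OF has_sum_imp_summable[OF g]] by simp_all
    show "((\<lambda>y. case (x, y) of (x, y) \<Rightarrow> \<bar>f x * g y\<bar>) has_sum \<bar>f x\<bar> * infsum (\<lambda>y. \<bar>g y\<bar>) B) B" for x
      using has_sum_cmult_right[OF has_sum_infsum[OF g']] by (simp add: abs_mult)
    show "(\<lambda>x. \<bar>f x\<bar> * infsum (\<lambda>y. \<bar>g y\<bar>) B) summable_on A"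
      using f' by (rule summable_on_cmult_left)
  qed auto
  then show "(\<lambda>(x, y). f x * g y) summable_on A \<times> B"
    by (subst summable_on_iff_abs_summable_on_real) (simp add: case_prod_unfold)
qed

text \<open>Makes each coefficient of a Cauchy product a finite sum: both summands are bounded by
  \<open>\<kappa>\<close> componentwise.\<close>

lemma finite_multi_index_decompositions:
  "finite {p :: ('n :: finite \<Rightarrow> nat) \<times> ('n \<Rightarrow> nat). (\<lambda>i. fst p i + snd p i) = \<kappa>}"
proof (rule finite_subset)
  show "{p. (\<lambda>i. fst p i + snd p i) = \<kappa>} \<subseteq> PiE UNIV (\<lambda>i. {..\<kappa> i}) \<times> PiE UNIV (\<lambda>i. {..\<kappa> i})"
    by (auto simp: fun_eq_iff) (metis le_add1 le_add2)+
  show "finite (PiE UNIV (\<lambda>i. {..\<kappa> i}) \<times> PiE UNIV (\<lambda>i. {..\<kappa> i}))"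
    by (intro finite_cartesian_product finite_PiE) auto
qed

text \<open>Cauchy product: the double series over pairs of multi-indices is summed in groups with
  equal \<nu> + \<mu>, because the monomials satisfy \<open>m_add\<close>.\<close>

lemma real_analytic_at_mult:
  fixes f g :: "real ^ 'n \<Rightarrow> real"
  assumes "real_analytic_at f x" "real_analytic_at g x"
  shows "real_analytic_at (\<lambda>y. f y * g y) x"
proof -
  define m where "m y \<nu> = (\<Prod>i\<in>UNIV. (y $ i - x $ i) ^ \<nu> i)" for y :: "real ^ 'n" and \<nu> :: "'n \<Rightarrow> nat"
  define D where "D \<kappa> = {p :: ('n \<Rightarrow> nat) \<times> ('n \<Rightarrow> nat). (\<lambda>i. fst p i + snd p i) = \<kappa>}" for \<kappa>
  obtain r a where r: "0 < r" and a: "\<And>y. y \<in> ball x r \<Longrightarrow> ((\<lambda>\<nu>. m y \<nu> *\<^sub>R a \<nu>) has_sum f y) UNIV"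
    unfolding m_def using assms(1) by (rule real_analytic_atE) blast
  obtain s b where s: "0 < s" and b: "\<And>y. y \<in> ball x s \<Longrightarrow> ((\<lambda>\<nu>. m y \<nu> *\<^sub>R b \<nu>) has_sum g y) UNIV"
    unfolding m_def using assms(2) by (rule real_analytic_atE) blast
  define c where "c \<kappa> = (\<Sum>p\<in>D \<kappa>. a (fst p) * b (snd p))" for \<kappa>
  have m_add: "m y (\<lambda>i. \<nu> i + \<mu> i) = m y \<nu> * m y \<mu>" for y \<nu> \<mu>
    by (simp add: m_def power_add prod.distrib)
  \<comment> \<open>The sets \<open>D \<kappa>\<close> partition all pairs of multi-indices.\<close>
  have bij: "bij_betw snd (Sigma UNIV D) UNIV"
    by (rule bij_betwI[where g = "\<lambda>p. ((\<lambda>i. fst p i + snd p i), p)"]) (auto simp: D_def)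
  have "((\<lambda>\<kappa>. m y \<kappa> * c \<kappa>) has_sum f y * g y) UNIV" if y: "y \<in> ball x (min r s)" for y
  proof (rule has_sum_SigmaD)
    let ?h = "\<lambda>(\<nu>, \<mu>). (m y \<nu> * a \<nu>) * (m y \<mu> * b \<mu>)"
    have "(?h has_sum f y * g y) (UNIV \<times> UNIV)"
      using y by (intro has_sum_mult_Times_real a[simplified] b[simplified]) auto
    then show "((\<lambda>q. ?h (snd q)) has_sum f y * g y) (Sigma UNIV D)"
      by (subst has_sum_reindex_bij_betw[OF bij, of ?h]) simp
    fix \<kappa>
    have "(\<Sum>p\<in>D \<kappa>. ?h p) = m y \<kappa> * c \<kappa>"
      unfolding c_def sum_distrib_left
      by (intro sum.cong) (auto simp: D_def m_add mult_ac split: prod.split)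
    then show "((\<lambda>p. ?h (snd (\<kappa>, p))) has_sum m y \<kappa> * c \<kappa>) (D \<kappa>)"
      using finite_multi_index_decompositions[of \<kappa>] by (intro has_sum_finiteI) (auto simp: D_def)
  qed
  then show ?thesis
    using r s by (intro real_analytic_atI[of "min r s" _ c]) (auto simp: m_def)
qed

text \<open>The finitely many components share the least of their radii, and \<open>has_sum\<close>
  in a finite-dimensional space is componentwise convergence.\<close>

lemma real_analytic_at_vec:
  fixes f :: "'m :: finite \<Rightarrow> real ^ 'n \<Rightarrow> real"
  assumes "\<And>j. real_analytic_at (f j) x"
  shows "real_analytic_at (\<lambda>y. \<chi> j. f j y) x"
proof -
  have "\<exists>r a. 0 < r \<and> (\<forall>y\<in>ball x r.
      ((\<lambda>\<nu>. (\<Prod>i\<in>UNIV. (y $ i - x $ i) ^ \<nu> i) *\<^sub>R a \<nu>) has_sum f j y) UNIV)" for j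
    using assms[of j] unfolding real_analytic_at_def by blast
  from choice[OF allI[OF this]] obtain r where "\<forall>j. \<exists>a. 0 < r j \<and> (\<forall>y\<in>ball x (r j).
      ((\<lambda>\<nu>. (\<Prod>i\<in>UNIV. (y $ i - x $ i) ^ \<nu> i) *\<^sub>R a \<nu>) has_sum f j y) UNIV)" ..
  from choice[OF this] obtain a where ra: "\<forall>j. 0 < r j \<and> (\<forall>y\<in>ball x (r j).
      ((\<lambda>\<nu>. (\<Prod>i\<in>UNIV. (y $ i - x $ i) ^ \<nu> i) *\<^sub>R a j \<nu>) has_sum f j y) UNIV)" ..
  then have r: "0 < r j" for j by simp
  define d where "d = Min (range r)"
  have d: "0 < d" "d \<le> r j" for j using r by (auto simp: d_def)
  have "((\<lambda>\<nu>. (\<Prod>i\<in>UNIV. (y $ i - x $ i) ^ \<nu> i) *\<^sub>R (\<chi> j. a j \<nu>)) has_sum (\<chi> j. f j y)) UNIV"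
    if "y \<in> ball x d" for y
    unfolding has_sum_def
  proof (rule vec_tendstoI)
    fix j
    have "y \<in> ball x (r j)" using that d(2)[of j] by auto
    from ra[rule_format, THEN conjunct2, rule_format, OF this]
    show "((\<lambda>S. (\<Sum>\<nu>\<in>S. (\<Prod>i\<in>UNIV. (y $ i - x $ i) ^ \<nu> i) *\<^sub>R (\<chi> j. a j \<nu>)) $ j)
        \<longlongrightarrow> (\<chi> j. f j y) $ j) (finite_subsets_at_top UNIV)"
      by (simp add: has_sum_def sum_component)
  qed
  then show ?thesis by (rule real_analytic_atI[OF d(1)])
qed

text \<open>The translation cancels in the differences, and the powers of \<open>s\<close> are
  absorbed into the coefficients; the radius becomes \<open>r / \<bar>s\<bar>\<close>.\<close>

lemma real_analytic_at_affine:
  fixes f :: "real ^ 'n \<Rightarrow> 'b :: real_normed_vector"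
  assumes "real_analytic_at f (s *\<^sub>R x + c)" "s \<noteq> 0"
  shows "real_analytic_at (\<lambda>y. f (s *\<^sub>R y + c)) x"
proof -
  obtain r a where r: "0 < r" and a: "\<And>y. y \<in> ball (s *\<^sub>R x + c) r \<Longrightarrow>
      ((\<lambda>\<nu>. (\<Prod>i\<in>UNIV. (y $ i - (s *\<^sub>R x + c) $ i) ^ \<nu> i) *\<^sub>R a \<nu>) has_sum f y) UNIV"
    using assms(1) by (rule real_analytic_atE) blast
  have "((\<lambda>\<nu>. (\<Prod>i\<in>UNIV. (y $ i - x $ i) ^ \<nu> i) *\<^sub>R (\<Prod>i\<in>UNIV. s ^ \<nu> i) *\<^sub>R a \<nu>) has_sum f (s *\<^sub>R y + c)) UNIV"
    if "y \<in> ball x (r / \<bar>s\<bar>)" for y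
  proof -
    have "dist (s *\<^sub>R x + c) (s *\<^sub>R y + c) = \<bar>s\<bar> * dist x y"
      by (simp add: dist_norm flip: scaleR_diff_right)
    then have "s *\<^sub>R y + c \<in> ball (s *\<^sub>R x + c) r"
      using that assms(2) by (simp add: pos_less_divide_eq mult.commute)
    from a[OF this] show ?thesis
      by (simp add: power_mult_distrib prod.distrib mult.commute flip: right_diff_distrib)
  qed
  moreover have "0 < r / \<bar>s\<bar>" using r assms(2) by simp
  ultimately show ?thesis by (intro real_analytic_atI) blast
qed

text \<open>The coefficient integrals in \<open>has_sum_exp_integral\<close> do not involve
  \<open>t\<close>, so putting t = \<alpha> - x yields a power series about \<open>x\<close> with
  radius \<open>r\<close>.\<close>

lemma real_analytic_at_exp_integral:
  fixes g :: "'n :: finite \<Rightarrow> 'a \<Rightarrow> real" and x :: "real ^ 'n"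
  assumes "f \<in> borel_measurable M" "\<And>i. g i \<in> borel_measurable M" "0 < r"
    and "\<And>t :: real ^ 'n. norm t < r \<Longrightarrow> integrable M (\<lambda>y. f y * exp (\<Sum>i\<in>UNIV. \<bar>t $ i * g i y\<bar>))"
  shows "real_analytic_at (\<lambda>\<alpha>. \<integral>y. f y * exp (\<Sum>i\<in>UNIV. (\<alpha> $ i - x $ i) * g i y) \<partial>M) x"
proof (rule real_analytic_atI)
  fix \<alpha> assume "\<alpha> \<in> ball x r"
  then have "norm (\<alpha> - x) < r" by (simp add: dist_norm norm_minus_commute)
  from assms(4)[OF this]
  show "((\<lambda>\<nu>. (\<Prod>i\<in>UNIV. (\<alpha> $ i - x $ i) ^ \<nu> i) *\<^sub>R (\<integral>y. f y * (\<Prod>i\<in>UNIV. g i y ^ \<nu> i / fact (\<nu> i)) \<partial>M)) has_sum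
      (\<integral>y. f y * exp (\<Sum>i\<in>UNIV. (\<alpha> $ i - x $ i) * g i y) \<partial>M)) UNIV"
    using has_sum_exp_integral[OF assms(1,2), of "\<lambda>i. \<alpha> $ i - x $ i"] by simp
qed fact

section \<open>The Gamma function\<close>

text \<open>As \<open>rGamma\<close> is entire, its complex Taylor series at a real point converges
  everywhere; on the real axis its real part is a real power series.\<close>

lemma rGamma_real_power_series:
  fixes x y :: real
  shows "((\<lambda>n. (y - x) ^ n * Re ((deriv ^^ n) rGamma (complex_of_real x) / fact n)) has_sum rGamma y) UNIV"
proof -
  define b where "b n = (deriv ^^ n) rGamma (complex_of_real x) / fact n" for n
  \<comment> \<open>\<open>R\<close> exceeds the distance from \<open>x\<close> to \<open>y\<close>,
    so convergence at \<open>x + R\<close> forces absolute convergence at \<open>y\<close>. The disc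
    of radius \<open>R + 1\<close> contains both points.\<close>
  define R where "R = \<bar>y - x\<bar> + 1"
  have ps: "(\<lambda>n. b n * (w - of_real x) ^ n) sums rGamma w" if "w \<in> ball (of_real x) (R + 1)" for w
    unfolding b_def by (rule holomorphic_power_series[OF holomorphic_rGamma that])
  have "of_real (x + R) \<in> ball (complex_of_real x) (R + 1)"
    by (simp add: dist_norm R_def norm_minus_commute flip: of_real_diff del: of_real_add)
  from sums_summable[OF ps[OF this]] have "summable (\<lambda>n. b n * of_real R ^ n)" by simp
  then have "summable (\<lambda>n. norm (b n * of_real (y - x) ^ n))"
    by (rule powser_insidea) (simp add: R_def flip: of_real_diff)
  moreover have "of_real y \<in> ball (complex_of_real x) (R + 1)"
    by (simp add: R_def dist_norm abs_minus_commute flip: of_real_diff)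
  from ps[OF this] have "(\<lambda>n. b n * of_real (y - x) ^ n) sums of_real (rGamma y)"
    by (simp add: rGamma_complex_of_real)
  ultimately have *: "((\<lambda>n. b n * of_real (y - x) ^ n) has_sum of_real (rGamma y)) UNIV"
    by (rule norm_summable_imp_has_sum)
  have "Re (b n * of_real (y - x) ^ n) = (y - x) ^ n * Re (b n)" for n
    unfolding of_real_power[symmetric] by simp
  with has_sum_Re[OF *] show ?thesis by (simp only: b_def Re_complex_of_real)
qed

lemma real_analytic_at_prod_rGamma:
  "real_analytic_at (\<lambda>\<alpha> :: real ^ 'n. \<Prod>i\<in>UNIV. rGamma (\<alpha> $ i)) x"
proof -
  have "((\<lambda>\<nu>. (\<Prod>i\<in>UNIV. (y $ i - x $ i) ^ \<nu> i) *\<^sub>R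
      (\<Prod>i\<in>UNIV. Re ((deriv ^^ \<nu> i) rGamma (complex_of_real (x $ i)) / fact (\<nu> i))))
      has_sum (\<Prod>i\<in>UNIV. rGamma (y $ i))) UNIV" for y
    using has_sum_prod_UNIV[OF rGamma_real_power_series, of "\<lambda>i. y $ i" "\<lambda>i. x $ i"]
    by (simp add: prod.distrib)
  \<comment> \<open>The expansion holds for every \<open>y\<close>, so any radius serves.\<close>
  then show ?thesis by (rule real_analytic_atI[OF zero_less_one])
qed

section \<open>Euler's integral and the analyticity of Gamma at a sum of coordinates\<close>

lemma powr_mult_exp_ln: "x powr a * exp (b * ln x) = x powr (a + b)" for x :: real
  \<comment> \<open>At \<open>x = 0\<close> both sides vanish, because
    \<open>0 powr a = 0\<close>.\<close>
  by (simp add: powr_def distrib_right exp_add)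

text \<open>Euler's integral is available as a gauge integral; nonnegativity of the integrand
  carries it over to the Lebesgue integral.\<close>

lemma Gamma_has_bochner_integral:
  fixes s :: real
  assumes "0 < s"
  shows "has_bochner_integral lborel (\<lambda>t. indicator {0..} t * (t powr (s - 1) / exp t)) (Gamma s)"
proof (rule has_bochner_integral_nn_integral)
  have "(\<integral>\<^sup>+t. ennreal (t powr (s - 1) / exp t) * indicator {0..} t \<partial>lborel) = ennreal (Gamma s)"
    using Gamma_integral_real[OF assms] by (intro nn_integral_has_integral_lebesgue') auto
  moreover have "ennreal (indicator {0..} t * (t powr (s - 1) / exp t)) =
      ennreal (t powr (s - 1) / exp t) * indicator {0..} t" for t
    by (simp add: indicator_def)
  ultimately show "(\<integral>\<^sup>+t. ennreal (indicator {0..} t * (t powr (s - 1) / exp t)) \<partial>lborel) = ennreal (Gamma s)"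
    by (simp only:)
qed (use assms in \<open>auto simp: Gamma_real_nonneg\<close>)

lemma sum_abs_nth_le_card_norm:
  "(\<Sum>i\<in>UNIV. \<bar>x $ i\<bar>) \<le> real CARD('n) * norm x" for x :: "real ^ 'n"
  using sum_bounded_above[of UNIV "\<lambda>i. \<bar>x $ i\<bar>" "norm x"] component_le_norm_cart[of x] by simp

lemma real_analytic_at_Gamma_sum:
  fixes x :: "real ^ 'n"
  assumes "0 < (\<Sum>i\<in>UNIV. x $ i)"
  shows "real_analytic_at (\<lambda>\<alpha>. Gamma (\<Sum>i\<in>UNIV. \<alpha> $ i)) x"
proof -
  define s where "s = (\<Sum>i\<in>UNIV. x $ i)"
  define G :: "real \<Rightarrow> real \<Rightarrow> real" where "G s t = indicator {0..} t * (t powr (s - 1) / exp t)" for s t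
  \<comment> \<open>Chosen so that \<open>norm u < r\<close> forces the absolute coordinates of
    \<open>u\<close> to sum to less than \<open>s\<close>; the exponents met below then stay
    positive.\<close>
  define r where "r = s / CARD('n)"
  have r: "0 < r" using assms by (simp add: r_def s_def)
  have u: "(\<Sum>i\<in>UNIV. \<bar>u $ i\<bar>) < s" if "norm u < r" for u :: "real ^ 'n"
  proof -
    have "real CARD('n) * norm u < s" using that by (simp add: r_def pos_less_divide_eq mult.commute)
    with sum_abs_nth_le_card_norm[of u] show ?thesis by simp
  qed
  have G: "integrable lborel (G a)" "integral\<^sup>L lborel (G a) = Gamma a" if "0 < a" for a
    using Gamma_has_bochner_integral[OF that] unfolding G_def
    by (auto simp: has_bochner_integral_iff)
  have shift: "G a t * exp (b * ln t) = G (a + b) t" for a b t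
    using powr_mult_exp_ln[of t "a - 1" b] by (simp add: G_def algebra_simps)
  have G_nonneg: "0 \<le> G a t" for a t by (simp add: G_def)
  have G_meas [measurable]: "G a \<in> borel_measurable lborel" for a unfolding G_def by measurable
  have "real_analytic_at (\<lambda>\<alpha>. \<integral>t. G s t * exp (\<Sum>i\<in>UNIV. (\<alpha> $ i - x $ i) * ln t) \<partial>lborel) x"
  proof (rule real_analytic_at_exp_integral[OF _ _ r])
    fix u :: "real ^ 'n" assume "norm u < r"
    define T where "T = (\<Sum>i\<in>UNIV. \<bar>u $ i\<bar>)"
    have T: "0 \<le> T" "T < s" using u[OF \<open>norm u < r\<close>] by (auto simp: T_def intro: sum_nonneg)
    have eq: "(\<Sum>i\<in>UNIV. \<bar>u $ i * ln t\<bar>) = T * \<bar>ln t\<bar>" for t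
      by (simp add: T_def abs_mult sum_distrib_right)
    show "integrable lborel (\<lambda>t. G s t * exp (\<Sum>i\<in>UNIV. \<bar>u $ i * ln t\<bar>))"
      unfolding eq
    proof (rule Bochner_Integration.integrable_bound[OF Bochner_Integration.integrable_add _ AE_I2])
      show "integrable lborel (G (s + T))" "integrable lborel (G (s + - T))"
        using T by (intro G(1); simp)+
      fix t
      \<comment> \<open>One summand controls large \<open>t\<close>, the other small
        \<open>t\<close>. The majorant is thus a sum of two Gamma integrands with parameters
        \<open>s + T\<close> and \<open>s - T\<close>, both positive.\<close>
      have "exp (T * \<bar>ln t\<bar>) \<le> exp (T * ln t) + exp (- T * ln t)"
        by (cases "0 \<le> ln t") auto
      from mult_left_mono[OF this G_nonneg[of s t]]
      have "G s t * exp (T * \<bar>ln t\<bar>) \<le> G (s + T) t + G (s + - T) t"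
        by (simp only: distrib_left shift)
      then show "norm (G s t * exp (T * \<bar>ln t\<bar>)) \<le> norm (G (s + T) t + G (s + - T) t)"
        using G_nonneg by (simp add: abs_mult)
    qed measurable
  qed measurable
  then show ?thesis
  proof (rule real_analytic_at_cong[OF _ r])
    fix \<alpha> assume "\<alpha> \<in> ball x r"
    then have "norm (\<alpha> - x) < r" by (simp add: dist_norm norm_minus_commute)
    from u[OF this] have "\<bar>\<Sum>i\<in>UNIV. \<alpha> $ i - x $ i\<bar> < s"
      unfolding vector_minus_component by (rule order_le_less_trans[OF sum_abs])
    then have pos: "0 < (\<Sum>i\<in>UNIV. \<alpha> $ i)" by (simp add: sum_subtractf s_def)
    have "G s t * exp (\<Sum>i\<in>UNIV. (\<alpha> $ i - x $ i) * ln t) = G (\<Sum>i\<in>UNIV. \<alpha> $ i) t" for t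
      unfolding sum_distrib_right[symmetric] shift by (simp add: sum_subtractf s_def)
    then show "Gamma (\<Sum>i\<in>UNIV. \<alpha> $ i) = (\<integral>t. G s t * exp (\<Sum>i\<in>UNIV. (\<alpha> $ i - x $ i) * ln t) \<partial>lborel)"
      using G(2)[OF pos] by simp
  qed
qed

section \<open>Dirichlet integrals\<close>

lemma nn_integral_powr_unit_finite:
  fixes b :: real
  assumes "0 < b"
  shows "(\<integral>\<^sup>+t. ennreal (indicator {0..1} t * t powr (b - 1)) \<partial>lborel) < \<infinity>"
proof -
  have "((\<lambda>t. t powr (b - 1)) has_integral (1 / b)) {0..1::real}"
    using has_integral_powr_from_0[of "b - 1" 1] assms by simp
  from nn_integral_has_integral_lebesgue'[OF _ this]
  have "(\<integral>\<^sup>+t. ennreal (t powr (b - 1)) * indicator {0..1} t \<partial>lborel) = ennreal (1 / b)" by simp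
  then have "(\<integral>\<^sup>+t. ennreal (indicator {0..1} t * t powr (b - 1)) \<partial>lborel) = ennreal (1 / b)"
    by (simp add: ennreal_mult' ennreal_indicator mult.commute)
  then show ?thesis by simp
qed

text \<open>Finiteness needs only an upper bound, so the constraint to the simplex may be dropped,
  leaving a product measure; \<open>k\<close> can be chosen freely by
  \<open>simplex_lborel_eq\<close>.\<close>

lemma nn_integral_simplex_lborel_le:
  fixes h :: "real ^ 'n \<Rightarrow> ennreal"
  assumes [measurable]: "h \<in> borel_measurable borel"
  shows "(\<integral>\<^sup>+y. h y \<partial>simplex_lborel) \<le> (\<integral>\<^sup>+z. h (simplex_chart k z) \<partial>(\<Pi>\<^sub>M i\<in>UNIV - {k}. lborel))"
proof -
  let ?D = "distr (\<Pi>\<^sub>M i\<in>UNIV - {k}. lborel) borel (simplex_chart k)"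
  have "(\<integral>\<^sup>+y. h y \<partial>simplex_lborel) = (\<integral>\<^sup>+y. h y * indicator std_simplex y \<partial>?D)"
    unfolding simplex_lborel_eq[of k] simplex_lborel_wrt_def
    by (rule nn_integral_restrict_space) simp
  also have "\<dots> \<le> (\<integral>\<^sup>+y. h y \<partial>?D)"
    by (intro nn_integral_mono) (auto simp: indicator_def)
  also have "\<dots> = (\<integral>\<^sup>+z. h (simplex_chart k z) \<partial>(\<Pi>\<^sub>M i\<in>UNIV - {k}. lborel))"
    by (rule nn_integral_distr) simp_all
  finally show ?thesis .
qed

lemma std_simplex_nth_le_1:
  assumes "y \<in> std_simplex"
  shows "y $ i \<le> 1"
  using assms member_le_sum[of i UNIV "\<lambda>i. y $ i"] by (simp add: std_simplex_def)

lemma measurable_nth_simplex_lborel [measurable]: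
  "(\<lambda>y. y $ i) \<in> borel_measurable simplex_lborel"
  unfolding measurable_cong_sets[OF sets_simplex_lborel refl]
  by (intro borel_measurable_continuous_on_restrict continuous_intros)

text \<open>
  Some coordinate k of a point of the simplex is at least 1/n, so its factor is bounded; in the
  chart that eliminates k, the other factors separate.
\<close>

lemma integrable_simplex_lborel_prod_powr:
  fixes \<beta> :: "real ^ 'n"
  assumes "\<And>i. 0 < \<beta> $ i"
  shows "integrable simplex_lborel (\<lambda>y. \<Prod>i\<in>UNIV. y $ i powr (\<beta> $ i - 1))"
proof (rule integrableI_bounded)
  define N where "N = real CARD('n)"
  \<comment> \<open>Cutting off to the unit interval changes nothing on the simplex but keeps each
    factor integrable over the whole line.\<close>
  define p where "p i t = indicator {0..1} t * t powr (\<beta> $ i - 1)" for i and t :: real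
  \<comment> \<open>Bounds the factor of coordinate \<open>k\<close> on [1/N, 1]: by 1 if its
    exponent is nonnegative, otherwise by its value at 1/N.\<close>
  define C where "C k = max 1 ((1 / N) powr (\<beta> $ k - 1))" for k
  define h where "h k y = ennreal (C k) * (\<Prod>i\<in>UNIV - {k}. ennreal (p i (y $ i)))" for k and y :: "real ^ 'n"
  have N: "0 < N" by (simp add: N_def)
  have p_meas [measurable]: "p i \<in> borel_measurable borel" for i unfolding p_def by measurable
  have p_nonneg: "0 \<le> p i t" for i t by (simp add: p_def)
  have C: "0 \<le> C k" for k by (simp add: C_def)
  have h_meas [measurable]: "h k \<in> borel_measurable borel" for k
    unfolding h_def by measurable
  have h_meas' [measurable]: "h k \<in> borel_measurable simplex_lborel" for k
    unfolding h_def by measurable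
  have bound: "ennreal (norm (\<Prod>i\<in>UNIV. y $ i powr (\<beta> $ i - 1))) \<le> (\<Sum>k\<in>UNIV. h k y)"
    if y: "y \<in> std_simplex" for y
  proof -
    have y01: "0 \<le> y $ i" "y $ i \<le> 1" for i
      using y std_simplex_nth_le_1[OF y] by (auto simp: std_simplex_def)
    have "\<exists>k. 1 / N \<le> y $ k"
    proof (rule ccontr)
      assume "\<nexists>k. 1 / N \<le> y $ k"
      then have "(\<Sum>k\<in>UNIV. y $ k) < (\<Sum>k\<in>(UNIV :: 'n set). 1 / N)"
        by (intro sum_strict_mono) (auto simp: not_le)
      then show False using y by (simp add: std_simplex_def N_def)
    qed
    then obtain k where k: "1 / N \<le> y $ k" ..
    have "y $ k powr (\<beta> $ k - 1) \<le> C k"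
    proof (cases "1 \<le> \<beta> $ k")
      case True
      then have "y $ k powr (\<beta> $ k - 1) \<le> 1 powr (\<beta> $ k - 1)"
        using y01 by (intro powr_mono2) auto
      then show ?thesis by (simp add: C_def)
    next
      case False
      then have "y $ k powr (\<beta> $ k - 1) \<le> (1 / N) powr (\<beta> $ k - 1)"
        using k N by (intro powr_mono2') auto
      then show ?thesis by (simp add: C_def)
    qed
    moreover have "(\<Prod>i\<in>UNIV - {k}. y $ i powr (\<beta> $ i - 1)) = (\<Prod>i\<in>UNIV - {k}. p i (y $ i))"
      using y01 by (simp add: p_def)
    ultimately have "(\<Prod>i\<in>UNIV. y $ i powr (\<beta> $ i - 1)) \<le> C k * (\<Prod>i\<in>UNIV - {k}. p i (y $ i))"
      using p_nonneg by (subst prod.remove[of UNIV k]) (auto intro!: mult_right_mono prod_nonneg)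
    then have "ennreal (norm (\<Prod>i\<in>UNIV. y $ i powr (\<beta> $ i - 1))) \<le> h k y"
      unfolding h_def prod_ennreal[OF p_nonneg] ennreal_mult'[OF C, symmetric]
      by (intro ennreal_leI) (simp add: abs_prod)
    \<comment> \<open>The large coordinate \<open>k\<close> depends on \<open>y\<close>; summing
      over all \<open>k\<close> gives one majorant for the whole simplex.\<close>
    also have "\<dots> \<le> (\<Sum>k\<in>UNIV. h k y)" by (rule member_le_sum) auto
    finally show ?thesis .
  qed
  interpret product_sigma_finite "\<lambda>_ :: 'n. (lborel :: real measure)"
    by standard
  have fin: "(\<integral>\<^sup>+y. h k y \<partial>simplex_lborel) < \<infinity>" for k
  proof -
    have "(\<integral>\<^sup>+y. h k y \<partial>simplex_lborel) \<le> (\<integral>\<^sup>+z. h k (simplex_chart k z) \<partial>(\<Pi>\<^sub>M i\<in>UNIV - {k}. lborel))"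
      by (rule nn_integral_simplex_lborel_le) measurable
    \<comment> \<open>\<open>h k\<close> ignores coordinate \<open>k\<close>, and the chart leaves
      the others unchanged, so the integrand is a product of functions of single variables.\<close>
    also have "\<dots> = (\<integral>\<^sup>+z. ennreal (C k) * (\<Prod>i\<in>UNIV - {k}. ennreal (p i (z i))) \<partial>(\<Pi>\<^sub>M i\<in>UNIV - {k}. lborel))"
      unfolding h_def by (intro nn_integral_cong) (auto simp: simplex_chart_def intro!: prod.cong)
    also have "\<dots> = ennreal (C k) * (\<integral>\<^sup>+z. (\<Prod>i\<in>UNIV - {k}. ennreal (p i (z i))) \<partial>(\<Pi>\<^sub>M i\<in>UNIV - {k}. lborel))"
      by (rule nn_integral_cmult) measurable
    also have "\<dots> = ennreal (C k) * (\<Prod>i\<in>UNIV - {k}. \<integral>\<^sup>+t. ennreal (p i t) \<partial>lborel)"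
      by (subst product_nn_integral_prod) simp_all
    also have "\<dots> < \<infinity>"
    proof -
      have "(\<integral>\<^sup>+t. ennreal (p i t) \<partial>lborel) \<noteq> top" for i
        using nn_integral_powr_unit_finite[OF assms[of i]] by (simp add: p_def)
      then have "(\<Prod>i\<in>UNIV - {k}. \<integral>\<^sup>+t. ennreal (p i t) \<partial>lborel) \<noteq> top"
        by (simp add: ennreal_prod_eq_top)
      then show ?thesis by (simp add: ennreal_mult_less_top less_top)
    qed
    finally show ?thesis .
  qed
  have "(\<integral>\<^sup>+y. ennreal (norm (\<Prod>i\<in>UNIV. y $ i powr (\<beta> $ i - 1))) \<partial>simplex_lborel)
      \<le> (\<integral>\<^sup>+y. (\<Sum>k\<in>UNIV. h k y) \<partial>simplex_lborel)"
    by (intro nn_integral_mono bound) simp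
  also have "\<dots> = (\<Sum>k\<in>UNIV. \<integral>\<^sup>+y. h k y \<partial>simplex_lborel)"
    by (rule nn_integral_sum) measurable
  also have "\<dots> < \<infinity>" using fin by simp
  finally show "(\<integral>\<^sup>+y. ennreal (norm (\<Prod>i\<in>UNIV. y $ i powr (\<beta> $ i - 1))) \<partial>simplex_lborel) < \<infinity>" .
qed measurable

lemma compact_std_simplex: "compact (std_simplex :: (real ^ 'n) set)"
proof -
  have "norm y \<le> 1" if "y \<in> std_simplex" for y :: "real ^ 'n"
    using norm_le_l1_cart[of y] that by (simp add: std_simplex_def)
  then have "std_simplex \<subseteq> cball (0 :: real ^ 'n) 1" by auto
  then show ?thesis
    using closed_std_simplex by (auto simp: compact_eq_bounded_closed intro: bounded_subset[OF bounded_cball])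
qed

text \<open>Here \<open>g i y = ln (y $ i)\<close>, which is nonpositive on the simplex. The
  majorant therefore only lowers each parameter \<open>x $ i\<close> by
  \<open>\<bar>t $ i\<bar>\<close>, and it stays integrable while the parameters remain
  positive.\<close>

lemma real_analytic_at_dirichlet_integral:
  fixes F :: "real ^ 'n \<Rightarrow> real" and x :: "real ^ 'n"
  assumes F: "continuous_on std_simplex F" and x: "\<And>i. 0 < x $ i"
  shows "real_analytic_at (\<lambda>\<alpha>. \<integral>y. F y * (\<Prod>i\<in>UNIV. y $ i powr (\<alpha> $ i - 1)) \<partial>simplex_lborel) x"
proof -
  \<comment> \<open>With this radius, each \<open>\<bar>t $ i\<bar>\<close> is at most
    \<open>norm t\<close> and hence below \<open>x $ i\<close>.\<close>
  define r where "r = Min (range (\<lambda>i. x $ i))"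
  have r: "0 < r" "r \<le> x $ i" for i using x by (auto simp: r_def)
  have F_meas [measurable]: "F \<in> borel_measurable simplex_lborel"
    unfolding measurable_cong_sets[OF sets_simplex_lborel refl]
    by (intro borel_measurable_continuous_on_restrict F)
  have "bounded (F ` std_simplex)"
    by (intro compact_imp_bounded compact_continuous_image F compact_std_simplex)
  then obtain K where K: "\<And>y. y \<in> std_simplex \<Longrightarrow> \<bar>F y\<bar> \<le> K"
    unfolding bounded_iff by auto
  let ?P = "\<lambda>(\<alpha> :: real ^ 'n) (y :: real ^ 'n). \<Prod>i\<in>UNIV. y $ i powr (\<alpha> $ i - 1)"
  have shift: "?P \<alpha> y * exp (\<Sum>i\<in>UNIV. t $ i * ln (y $ i)) = ?P (\<alpha> + t) y" for \<alpha> t y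
    by (simp add: exp_sum powr_mult_exp_ln diff_add_eq flip: prod.distrib)
  have "real_analytic_at (\<lambda>\<alpha>. \<integral>y. F y * ?P x y * exp (\<Sum>i\<in>UNIV. (\<alpha> $ i - x $ i) * ln (y $ i)) \<partial>simplex_lborel) x"
  proof (rule real_analytic_at_exp_integral[OF _ _ r(1)])
    fix t :: "real ^ 'n" assume t: "norm t < r"
    define \<beta> where "\<beta> = x + (\<chi> i. - \<bar>t $ i\<bar>)"
    have "\<bar>t $ i\<bar> < x $ i" for i
      using component_le_norm_cart[of t i] t r(2)[of i] by simp
    then have int: "integrable simplex_lborel (\<lambda>y. K * ?P \<beta> y)"
      by (intro integrable_mult_right integrable_simplex_lborel_prod_powr) (simp add: \<beta>_def)
    show "integrable simplex_lborel (\<lambda>y. F y * ?P x y * exp (\<Sum>i\<in>UNIV. \<bar>t $ i * ln (y $ i)\<bar>))"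
    proof (rule Bochner_Integration.integrable_bound[OF int _ AE_I2])
      fix y :: "real ^ 'n" assume "y \<in> space simplex_lborel"
      then have y: "y \<in> std_simplex" by simp
      \<comment> \<open>On the boundary this uses the convention \<open>ln 0 = 0\<close>; there
        \<open>?P\<close> vanishes, so \<open>shift\<close> still holds.\<close>
      have "ln (y $ i) \<le> 0" for i
        using y std_simplex_nth_le_1[OF y, of i] by (cases "y $ i = 0") (auto simp: std_simplex_def less_le)
      then have "(\<Sum>i\<in>UNIV. \<bar>t $ i * ln (y $ i)\<bar>) = (\<Sum>i\<in>UNIV. (\<chi> i. - \<bar>t $ i\<bar>) $ i * ln (y $ i))"
        by (simp add: abs_mult)
      then have "F y * ?P x y * exp (\<Sum>i\<in>UNIV. \<bar>t $ i * ln (y $ i)\<bar>) = F y * ?P \<beta> y"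
        by (simp only: mult.assoc shift \<beta>_def)
      moreover have "\<bar>F y * ?P \<beta> y\<bar> \<le> \<bar>K * ?P \<beta> y\<bar>"
        unfolding abs_mult using order_trans[OF K[OF y] abs_ge_self] by (intro mult_right_mono) auto
      ultimately show "norm (F y * ?P x y * exp (\<Sum>i\<in>UNIV. \<bar>t $ i * ln (y $ i)\<bar>)) \<le> norm (K * ?P \<beta> y)"
        by (simp only: real_norm_def)
    qed measurable
  qed measurable
  moreover have "F y * ?P x y * exp (\<Sum>i\<in>UNIV. (\<alpha> $ i - x $ i) * ln (y $ i)) = F y * ?P \<alpha> y" for \<alpha> y
    using shift[of y x "\<alpha> - x"] by (simp add: mult.assoc)
  ultimately show ?thesis by (simp only:)
qed

section \<open>Factorisation of the smoothing and conclusion\<close>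

lemma dirichlet_smoothing_nth:
  fixes F :: "real ^ 'n \<Rightarrow> real ^ 'n"
  assumes "continuous_on std_simplex F" and "\<alpha> = (1 / \<epsilon>) *\<^sub>R \<sigma> + c" and "\<And>i. 0 < \<alpha> $ i"
  shows "dirichlet_smoothing F c \<epsilon> \<sigma> $ j = Gamma (\<Sum>i\<in>UNIV. \<alpha> $ i) * (\<Prod>i\<in>UNIV. rGamma (\<alpha> $ i)) *
    (\<integral>y. F y $ j * (\<Prod>i\<in>UNIV. y $ i powr (\<alpha> $ i - 1)) \<partial>simplex_lborel)"
proof -
  \<comment> \<open>Writing the normalising constant with \<open>rGamma\<close> exhibits each
    component as a product of three factors already known to be analytic in \<alpha>.\<close>
  have "(\<Prod>i\<in>UNIV. rGamma (\<alpha> $ i)) = inverse (\<Prod>i\<in>UNIV. Gamma (\<alpha> $ i))"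
    unfolding rGamma_inverse_Gamma by (rule prod_inversef[unfolded o_def])
  then have B: "1 / multi_Beta \<alpha> = Gamma (\<Sum>i\<in>UNIV. \<alpha> $ i) * (\<Prod>i\<in>UNIV. rGamma (\<alpha> $ i))"
    by (simp add: multi_Beta_def divide_inverse)
  have "dirichlet_smoothing F c \<epsilon> \<sigma> $ j = (\<integral>y. 1 / multi_Beta \<alpha> *
      (F y $ j * (\<Prod>i\<in>UNIV. y $ i powr (\<alpha> $ i - 1))) \<partial>simplex_lborel)"
    unfolding dirichlet_smoothing_eq_integral_density[OF assms(1) assms(3)[unfolded assms(2)], folded assms(2)]
      dirichlet_density_def
    by (simp only: mult.left_commute)
  then show ?thesis unfolding integral_mult_right_zero B .
qed

theorem proposition1:
  fixes F :: "real ^ 'n \<Rightarrow> real ^ 'n" and c :: "real ^ 'n"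
  assumes "continuous_on std_simplex F"
    and "\<forall>i. 0 < c $ i"
  shows "\<forall>\<epsilon> > 0. real_analytic_on (dirichlet_smoothing F c \<epsilon>) std_simplex"
proof (intro allI impI)
  fix \<epsilon> :: real assume \<epsilon>: "0 < \<epsilon>"
  define A where "A \<sigma> = (1 / \<epsilon>) *\<^sub>R \<sigma> + c" for \<sigma>
  \<comment> \<open>The set where the Dirichlet parameters are positive. It is open and, as
    \<open>c\<close> is strictly positive, contains the simplex together with its boundary.\<close>
  define U where "U = {\<sigma>. \<forall>i. 0 < A \<sigma> $ i}"
  define H where "H j \<alpha> = Gamma (\<Sum>i\<in>UNIV. \<alpha> $ i) * (\<Prod>i\<in>UNIV. rGamma (\<alpha> $ i)) *
    (\<integral>y. F y $ j * (\<Prod>i\<in>UNIV. y $ i powr (\<alpha> $ i - 1)) \<partial>simplex_lborel)" for j and \<alpha> :: "real ^ 'n"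
  have "U = (\<Inter>i. {\<sigma>. 0 < A \<sigma> $ i})" by (auto simp: U_def)
  then have U: "open U"
    unfolding A_def by (simp only:) (intro open_INT ballI finite open_Collect_less continuous_intros)
  have "0 < A \<sigma> $ i" if "\<sigma> \<in> std_simplex" for \<sigma> i
    using that assms(2) \<epsilon> by (simp add: A_def std_simplex_def add_nonneg_pos)
  then have sub: "std_simplex \<subseteq> U" by (auto simp: U_def)
  have "real_analytic_at (dirichlet_smoothing F c \<epsilon>) \<sigma>" if \<sigma>: "\<sigma> \<in> U" for \<sigma>
  proof -
    have pos: "0 < A \<sigma> $ i" for i using \<sigma> by (simp add: U_def)
    then have "0 < (\<Sum>i\<in>UNIV. A \<sigma> $ i)" by (intro sum_pos) auto
    then have "real_analytic_at (H j) (A \<sigma>)" for j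
      unfolding H_def using pos assms(1)
      by (intro real_analytic_at_mult real_analytic_at_Gamma_sum real_analytic_at_prod_rGamma
          real_analytic_at_dirichlet_integral continuous_intros)
    then have A: "real_analytic_at (\<lambda>\<tau>. \<chi> j. H j (A \<tau>)) \<sigma>"
      unfolding A_def using \<epsilon>
      by (intro real_analytic_at_affine[where f = "\<lambda>\<alpha>. \<chi> j. H j \<alpha>"] real_analytic_at_vec) simp_all
    \<comment> \<open>The factorisation is established for positive parameters, so the comparison
      with \<open>H\<close> is made on a ball inside \<open>U\<close>.\<close>
    obtain d where d: "0 < d" "ball \<sigma> d \<subseteq> U"
      using openE[OF U \<sigma>] .
    have "dirichlet_smoothing F c \<epsilon> \<tau> = (\<chi> j. H j (A \<tau>))" if "\<tau> \<in> ball \<sigma> d" for \<tau>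
    proof -
      have "0 < A \<tau> $ i" for i using d(2) that by (auto simp: U_def)
      from dirichlet_smoothing_nth[OF assms(1) A_def this] show ?thesis
        by (simp only: vec_eq_iff vec_lambda_beta H_def simp_thms)
    qed
    then show ?thesis by (rule real_analytic_at_cong[OF A d(1)])
  qed
  with U sub show "real_analytic_on (dirichlet_smoothing F c \<epsilon>) std_simplex"
    unfolding real_analytic_on_def by (intro ballI exI[of _ U]) auto
qed

end
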